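(* Let $X$ be a Peano continuum that is either one-dimensional or an absolute neighborhood retract. Then $\mathrm{LC}(X)$ is dense in $\mathrm{C}(X)$.
   Context: A continuum is a compact connected metrizable space; a Peano continuum is a locally connected continuum. Dimension is topological (covering) dimension. An absolute neighborhood retract is a compact space homeomorphic to a neighborhood retract of the Hilbert cube (a subset $A$ of the Hilbert cube $Q$ for which there are a neighborhood $U$ of $A$ in $Q$ and a retraction $U\to A$). $\mathrm{C}(X)$ is the space of all continuous maps $X\to X$ with the topology of uniform convergence. $\mathrm{LC}(X)$ is the set of $f\in \mathrm{C}(X)$ for which there is a dense set $D\subseteq X$ such that every $x\in D$ has a neighborhood $U$ with $f|_U$ constant. *)

theory Defs
  imports "HOL-Analysis.Analysis"
begin

definition continuum :: "'a topology \<Rightarrow> bool" where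
  "continuum X \<longleftrightarrow> compact_space X \<and> connected_space X \<and> metrizable_space X"

definition peano_continuum :: "'a topology \<Rightarrow> bool" where
  "peano_continuum X \<longleftrightarrow> continuum X \<and> locally_connected_space X"

(* Neighbourhoods need not be open. *)
definition neighbourhood_of :: "'a topology \<Rightarrow> 'a set \<Rightarrow> 'a set \<Rightarrow> bool" where
  "neighbourhood_of X A U \<longleftrightarrow> U \<subseteq> topspace X \<and> (\<exists>V. openin X V \<and> A \<subseteq> V \<and> V \<subseteq> U)"

(* Covering dimension at most n.  The relation dim_le of HOL-Analysis is the small
   inductive dimension and is not used here. *)
definition covering_dim_le :: "'a topology \<Rightarrow> nat \<Rightarrow> bool" where
  "covering_dim_le X n \<longleftrightarrow>
     (\<forall>\<U>. finite \<U> \<and> (\<forall>U\<in>\<U>. openin X U) \<and> \<Union>\<U> = topspace X \<longrightarrow>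
        (\<exists>\<V>. finite \<V> \<and> (\<forall>V\<in>\<V>. openin X V) \<and> \<Union>\<V> = topspace X \<and>
             (\<forall>V\<in>\<V>. \<exists>U\<in>\<U>. V \<subseteq> U) \<and>
             (\<forall>x\<in>topspace X. card {V \<in> \<V>. x \<in> V} \<le> n + 1)))"

definition one_dimensional :: "'a topology \<Rightarrow> bool" where
  "one_dimensional X \<longleftrightarrow> covering_dim_le X 1 \<and> \<not> covering_dim_le X 0"

definition hilbert_cube :: "(nat \<Rightarrow> real) topology" where
  "hilbert_cube = product_topology (\<lambda>_. top_of_set {0..1}) UNIV"

(* The constant ANR of HOL-Analysis is only adequate for subsets of Euclidean spaces. *)
definition compact_ANR :: "'a topology \<Rightarrow> bool" where
  "compact_ANR X \<longleftrightarrow> compact_space X \<and>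
     (\<exists>A U. neighbourhood_of hilbert_cube A U \<and>
            A retract_of_space (subtopology hilbert_cube U) \<and>
            X homeomorphic_space (subtopology hilbert_cube A))"

(* Maps are extensional, so that two of them are equal iff they agree on the space. *)
definition C_maps :: "'a topology \<Rightarrow> ('a \<Rightarrow> 'a) set" where
  "C_maps X = {f \<in> extensional (topspace X). continuous_map X X f}"

definition LC_maps :: "'a topology \<Rightarrow> ('a \<Rightarrow> 'a) set" where
  "LC_maps X = {f \<in> C_maps X. \<exists>D. D \<subseteq> topspace X \<and> X closure_of D = topspace X \<and>
                  (\<forall>x\<in>D. \<exists>U. neighbourhood_of X {x} U \<and> f constant_on U)}"

(* The topology of uniform convergence on the continuous self-maps of the metric space m.
   If the space is compact, it depends only on the topology induced by m. *)
definition uniform_topology :: "'a metric \<Rightarrow> ('a \<Rightarrow> 'a) topology" where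
  "uniform_topology m = topology (\<lambda>W. W \<subseteq> C_maps (mtopology_of m) \<and>
     (\<forall>f\<in>W. \<exists>e>0. \<forall>g\<in>C_maps (mtopology_of m).
        (\<forall>x\<in>mspace m. mdist m (f x) (g x) < e) \<longrightarrow> g \<in> W))"

lemma openin_uniform_topology:
  "openin (uniform_topology m) W \<longleftrightarrow> W \<subseteq> C_maps (mtopology_of m) \<and>
     (\<forall>f\<in>W. \<exists>e>0. \<forall>g\<in>C_maps (mtopology_of m).
        (\<forall>x\<in>mspace m. mdist m (f x) (g x) < e) \<longrightarrow> g \<in> W)"
proof -
  let ?C = "C_maps (mtopology_of m)"
  let ?P = "\<lambda>W. W \<subseteq> ?C \<and>
     (\<forall>f\<in>W. \<exists>e>0. \<forall>g\<in>?C. (\<forall>x\<in>mspace m. mdist m (f x) (g x) < e) \<longrightarrow> g \<in> W)"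
  have "istopology ?P"
    unfolding istopology_def
  proof (intro conjI allI impI)
    fix S T assume S: "?P S" and T: "?P T"
    show "S \<inter> T \<subseteq> ?C"
      using S by blast
    show "\<forall>f\<in>S \<inter> T. \<exists>e>0. \<forall>g\<in>?C. (\<forall>x\<in>mspace m. mdist m (f x) (g x) < e) \<longrightarrow> g \<in> S \<inter> T"
    proof
      fix f assume f: "f \<in> S \<inter> T"
      obtain d where d: "d > 0" "\<And>g. g \<in> ?C \<Longrightarrow> \<forall>x\<in>mspace m. mdist m (f x) (g x) < d \<Longrightarrow> g \<in> S"
        using S f by (metis IntD1)
      obtain e where e: "e > 0" "\<And>g. g \<in> ?C \<Longrightarrow> \<forall>x\<in>mspace m. mdist m (f x) (g x) < e \<Longrightarrow> g \<in> T"
        using T f by (metis IntD2)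
      show "\<exists>e>0. \<forall>g\<in>?C. (\<forall>x\<in>mspace m. mdist m (f x) (g x) < e) \<longrightarrow> g \<in> S \<inter> T"
        using d e by (intro exI[of _ "min d e"]) auto
    qed
  next
    fix \<K> assume K: "\<forall>K\<in>\<K>. ?P K"
    show "\<Union>\<K> \<subseteq> ?C"
      using K by blast
    show "\<forall>f\<in>\<Union>\<K>. \<exists>e>0. \<forall>g\<in>?C. (\<forall>x\<in>mspace m. mdist m (f x) (g x) < e) \<longrightarrow> g \<in> \<Union>\<K>"
      using K by (meson UnionE UnionI)
  qed
  then show ?thesis
    by (simp add: uniform_topology_def topology_inverse')
qed

lemma topspace_uniform_topology [simp]:
  "topspace (uniform_topology m) = C_maps (mtopology_of m)"
proof
  show "topspace (uniform_topology m) \<subseteq> C_maps (mtopology_of m)"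
    unfolding topspace_def by (auto simp: openin_uniform_topology)
  have "openin (uniform_topology m) (C_maps (mtopology_of m))"
    by (auto simp: openin_uniform_topology intro: gt_ex)
  then show "C_maps (mtopology_of m) \<subseteq> topspace (uniform_topology m)"
    by (rule openin_subset)
qed

end

theory Submission
  imports Defs
begin

text \<open>
  If \<open>h\<close> is a self-map of \<open>X\<close> close to the identity and locally constant on a dense open set, then
  \<open>f \<circ> h\<close> is locally constant on the same set and, \<open>f\<close> being uniformly continuous, close to \<open>f\<close>.
  So only the identity has to be approximated.

  The local constancy always comes from a real function \<open>\<phi>\<close> of Cantor type: a continuous self-map of
  \<open>[0,1]\<close> that is constant on some subinterval of every interval. If \<open>X\<close> is locally connected and
  \<open>u\<close> maps \<open>X\<close> continuously to \<open>[0,1]\<close>, then \<open>\<phi> \<circ> u\<close> is locally constant on a dense open set: a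
  connected open set is mapped by \<open>u\<close> either to a point or to an interval, and an interval contains
  a piece on which \<open>\<phi>\<close> is constant (\<open>generically_constant_staircase\<close>). Dense open sets
  can be intersected finitely often, so it suffices to approximate the identity by a map whose
  value at \<open>x\<close> depends only on the values at \<open>x\<close> of finitely many such functions \<open>\<phi> \<circ> u\<close> and on the
  membership of \<open>x\<close> in finitely many closed sets.

  For an ANR, embed \<open>X\<close> in the Hilbert cube, apply a \<open>\<phi>\<close> close to the identity to the first \<open>N\<close>
  coordinates, replace the others by 0, and retract the result to \<open>X\<close>. For large \<open>N\<close> the
  perturbed points stay in the neighbourhood where the retraction is defined and are moved little
  by it (\<open>ANR_identity_approximation\<close>).

  For a one-dimensional \<open>X\<close>, take a fine finite open cover in which no point lies in three members.
  Its nerve is a graph; pick a point in every member of the cover, and for every edge of the nerve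
  a short path between the two chosen points. The canonical map to the nerve followed by these
  paths is close to the identity; running through each edge with the time change \<open>\<phi>\<close> makes it
  locally constant (\<open>one_dimensional_identity_approximation\<close>). The paths exist because a compact
  locally connected metric space is uniformly locally path connected.
\<close>

section \<open>Properties of arbitrarily small open sets\<close>

text \<open>
  Here \<open>P\<close> is a property of open sets, such as \<open>f\<close> being constant on them. If \<open>P\<close> is inherited by
  subsets, this says that the union of all open sets with property \<open>P\<close> is dense; the
  formulation with nested open sets makes finite intersections of dense open sets immediate.
\<close>
definition generically :: "'a topology \<Rightarrow> ('a set \<Rightarrow> bool) \<Rightarrow> bool" where
  "generically X P \<longleftrightarrow> (\<forall>W. openin X W \<and> W \<noteq> {} \<longrightarrow> (\<exists>V. openin X V \<and> V \<noteq> {} \<and> V \<subseteq> W \<and> P V))"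

lemma generically_mono:
  assumes "generically X P" and "\<And>V. openin X V \<Longrightarrow> V \<noteq> {} \<Longrightarrow> P V \<Longrightarrow> Q V"
  shows "generically X Q"
  unfolding generically_def
proof (intro allI impI)
  fix W assume "openin X W \<and> W \<noteq> {}"
  then obtain V where "openin X V" "V \<noteq> {}" "V \<subseteq> W" "P V"
    using assms(1) unfolding generically_def by blast
  then show "\<exists>V. openin X V \<and> V \<noteq> {} \<and> V \<subseteq> W \<and> Q V" using assms(2) by blast
qed

lemma generically_conj:
  assumes "generically X P" "generically X Q" "\<And>V W. P W \<Longrightarrow> V \<subseteq> W \<Longrightarrow> P V"
  shows "generically X (\<lambda>V. P V \<and> Q V)"
  unfolding generically_def
proof (intro allI impI)
  fix W assume "openin X W \<and> W \<noteq> {}"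
  then obtain V where V: "openin X V" "V \<noteq> {}" "V \<subseteq> W" "P V"
    using assms(1) unfolding generically_def by blast
  then obtain V' where V': "openin X V'" "V' \<noteq> {}" "V' \<subseteq> V" "Q V'"
    using assms(2) unfolding generically_def by blast
  show "\<exists>V. openin X V \<and> V \<noteq> {} \<and> V \<subseteq> W \<and> P V \<and> Q V"
    using V V' assms(3)[of V V'] by (intro exI[of _ V']) blast
qed

lemma generically_ball_finite:
  assumes "finite I" and "\<And>i. i \<in> I \<Longrightarrow> generically X (P i)"
    and "\<And>i V W. i \<in> I \<Longrightarrow> P i W \<Longrightarrow> V \<subseteq> W \<Longrightarrow> P i V"
  shows "generically X (\<lambda>V. \<forall>i\<in>I. P i V)"
  using assms
proof (induction I)
  case empty
  then show ?case by (auto simp: generically_def)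
next
  case (insert i I)
  have "generically X (\<lambda>V. \<forall>i\<in>I. P i V)"
    by (rule insert.IH) (use insert.prems in \<open>meson insertI2\<close>)+
  moreover have "generically X (P i)"
    by (rule insert.prems) simp
  moreover have "P i V" if "P i W" "V \<subseteq> W" for V W
    using insert.prems(2)[of i] that by simp
  ultimately show ?case
    by (simp add: generically_conj)
qed

text \<open>
  The boundary of a closed set is nowhere dense. This takes the place of Baire's theorem: given
  finitely many closed sets that cover the space, some open subset of any nonempty open set lies
  in one of them.
\<close>
lemma generically_closed_decided:
  assumes "closedin X F"
  shows "generically X (\<lambda>V. V \<subseteq> F \<or> V \<inter> F = {})"
  unfolding generically_def
proof (intro allI impI)
  fix W assume W: "openin X W \<and> W \<noteq> {}"
  show "\<exists>V. openin X V \<and> V \<noteq> {} \<and> V \<subseteq> W \<and> (V \<subseteq> F \<or> V \<inter> F = {})"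
  proof (cases "W \<subseteq> F")
    case False
    then show ?thesis using W assms by (intro exI[of _ "W - F"]) auto
  qed (use W in blast)
qed

lemma LC_mapsI:
  assumes h: "h \<in> C_maps X" and gen: "generically X (\<lambda>V. h constant_on V)"
  shows "h \<in> LC_maps X"
proof -
  define D where "D = \<Union>{V. openin X V \<and> h constant_on V}"
  have "D \<subseteq> topspace X" unfolding D_def by (auto dest: openin_subset)
  moreover have "X closure_of D = topspace X"
    unfolding dense_intersects_open
  proof (intro allI impI)
    fix W assume "openin X W \<and> W \<noteq> {}"
    then obtain V where "openin X V" "V \<noteq> {}" "V \<subseteq> W" "h constant_on V"
      using gen unfolding generically_def by blast
    then show "D \<inter> W \<noteq> {}" unfolding D_def by blast
  qed
  moreover have "\<exists>U. neighbourhood_of X {x} U \<and> h constant_on U" if "x \<in> D" for x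
    using that openin_subset unfolding D_def neighbourhood_of_def by blast
  ultimately show ?thesis using h unfolding LC_maps_def by blast
qed

section \<open>Functions of Cantor type on the unit interval\<close>

text \<open>
  Functions like the Cantor function. The values at 0 and 1 ensure that replacing a path
  \<open>\<gamma>\<close> by \<open>\<gamma> \<circ> \<phi>\<close> keeps its end points.
\<close>
definition staircase :: "(real \<Rightarrow> real) \<Rightarrow> bool" where
  "staircase \<phi> \<longleftrightarrow> continuous_on {0..1} \<phi> \<and> \<phi> \<in> {0..1} \<rightarrow> {0..1} \<and> \<phi> 0 = 0 \<and> \<phi> 1 = 1 \<and>
     (\<forall>a b. 0 \<le> a \<and> a < b \<and> b \<le> 1 \<longrightarrow> (\<exists>c d. a \<le> c \<and> c < d \<and> d \<le> b \<and> \<phi> constant_on {c..d}))"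

text \<open>
  The rationals form a null set, so outer regularity gives open sets of small measure around them.
\<close>
lemma open_dense_small_measure:
  fixes e :: real
  assumes "e > 0"
  obtains T :: "real set" where "open T" "\<rat> \<subseteq> T" "T \<in> lmeasurable" "measure lebesgue T < e"
proof -
  have Q: "negligible (\<rat> :: real set)"
    by (simp add: countable_rat negligible_iff_null_sets countable_imp_null_set_lborel null_sets_completionI)
  then have "(\<rat> :: real set) \<in> sets lebesgue"
    by (rule negligible_imp_sets)
  then obtain T :: "real set" where T: "open T" "\<rat> \<subseteq> T" "(T - \<rat>) \<in> lmeasurable"
      "emeasure lebesgue (T - \<rat>) < ennreal e"
    by (rule sets_lebesgue_outer_open[OF _ assms])
  have Q': "(\<rat> :: real set) \<in> lmeasurable" "measure lebesgue (\<rat> :: real set) = 0"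
    using Q by (auto simp: negligible_imp_measurable negligible_imp_measure0)
  have "T = (T - \<rat>) \<union> \<rat>" using T(2) by auto
  then have "T \<in> lmeasurable" "measure lebesgue T \<le> measure lebesgue (T - \<rat>) + measure lebesgue (\<rat> :: real set)"
    using fmeasurable.Un[OF T(3) Q'(1)] measure_Un_le[OF fmeasurableD[OF T(3)] fmeasurableD[OF Q'(1)]] by auto
  moreover have "measure lebesgue (T - \<rat>) < e"
    using T(3,4) assms by (simp add: emeasure_eq_measure2 ennreal_less_iff)
  ultimately show thesis using that[OF T(1,2)] Q' by simp
qed

text \<open>
  For an open set \<open>T \<supseteq> \<rat>\<close> of measure less than \<open>\<delta>\<close>, the measure of \<open>[0,x] - T\<close> is a 1-Lipschitz
  function of \<open>x\<close>, constant on every interval inside \<open>T\<close>, and between \<open>x - \<delta>\<close> and \<open>x\<close>. Dividing it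
  by its value at 1 gives the required function.
\<close>
lemma staircase_close_to_identity:
  fixes e :: real
  assumes "e > 0"
  obtains \<phi> where "staircase \<phi>" "\<And>t. t \<in> {0..1} \<Longrightarrow> \<bar>\<phi> t - t\<bar> < e"
proof -
  \<comment> \<open>Normalising costs at most another \<open>\<delta>\<close>, so the total error is at most \<open>2 \<delta>\<close>.\<close>
  define \<delta> where "\<delta> = min (e/3) (1/2)"
  have \<delta>: "0 < \<delta>" "\<delta> \<le> 1/2" "2 * \<delta> < e" using assms by (auto simp: \<delta>_def)
  obtain T :: "real set" where T: "open T" "\<rat> \<subseteq> T" "T \<in> lmeasurable" "measure lebesgue T < \<delta>"
    using open_dense_small_measure[OF \<delta>(1)] .
  define \<psi> where "\<psi> x = measure lebesgue ({0..x} - T)" for x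
  have lm: "{x..y} - T \<in> lmeasurable" "{x<..y} - T \<in> lmeasurable" "{x..y} \<inter> T \<in> lmeasurable" for x y
    using T(3) by (auto intro!: fmeasurable.Diff fmeasurable.Int lmeasurable_interval bounded_set_imp_lmeasurable)
  have diff: "\<psi> y - \<psi> x = measure lebesgue ({x<..y} - T)" if "0 \<le> x" "x \<le> y" for x y
  proof -
    have "{0..y} - T = ({0..x} - T) \<union> ({x<..y} - T)" "({0..x} - T) \<inter> ({x<..y} - T) = {}"
      using that by auto
    then show ?thesis
      unfolding \<psi>_def using measure_Un2[OF lm(1)[of 0 x] lm(2)[of x y]] 
      by (simp add: Diff_triv Int_commute)
  qed
  have mono: "\<psi> x \<le> \<psi> y" and lip: "\<psi> y - \<psi> x \<le> y - x" if "0 \<le> x" "x \<le> y" for x y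
  proof -
    show "\<psi> x \<le> \<psi> y" using diff[OF that] by (metis diff_ge_0_iff_ge measure_nonneg)
    have "measure lebesgue ({x<..y} - T) \<le> measure lebesgue {x<..y}"
      using lm by (intro measure_mono_fmeasurable) (auto intro: bounded_set_imp_lmeasurable)
    then show "\<psi> y - \<psi> x \<le> y - x" using diff[OF that] that by simp
  qed
  have psi0: "\<psi> 0 = 0"
  proof -
    have "\<psi> 0 \<le> measure lebesgue {0..0::real}"
      unfolding \<psi>_def using lm(1)[of 0 0] by (intro measure_mono_fmeasurable) (auto simp del: atLeastAtMost_singleton)
    then show ?thesis using measure_nonneg[of lebesgue "{0..0} - T"] by (simp add: \<psi>_def antisym)
  qed
  have lower: "x - \<delta> \<le> \<psi> x" if "0 \<le> x" for x
  proof -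
    have eq: "({0..x} - T) \<union> ({0..x} \<inter> T) = {0..x}" "({0..x} \<inter> T) - ({0..x} - T) = {0..x} \<inter> T"
      by auto
    have "measure lebesgue {0..x} = \<psi> x + measure lebesgue ({0..x} \<inter> T)"
      using measure_Un2[OF lm(1)[of 0 x] lm(3)[of 0 x]] unfolding eq \<psi>_def .
    moreover have "measure lebesgue ({0..x} \<inter> T) \<le> measure lebesgue T"
      using lm T by (intro measure_mono_fmeasurable) auto
    ultimately show ?thesis using T(4) that by simp
  qed
  define c where "c = \<psi> 1"
  have upper: "\<psi> x \<le> x" if "0 \<le> x" for x using lip[of 0 x] that psi0 by simp
  have c: "1 - \<delta> \<le> c" "c \<le> 1" "0 < c" using lower[of 1] upper[of 1] \<delta> by (auto simp: c_def)
  define \<phi> where "\<phi> x = \<psi> x / c" for x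
  have "staircase \<phi>"
    unfolding staircase_def
  proof (intro conjI allI impI)
    have "\<bar>\<psi> y - \<psi> x\<bar> \<le> \<bar>y - x\<bar>" if "0 \<le> x" "0 \<le> y" for x y
      using mono[of x y] mono[of y x] lip[of x y] lip[of y x] that by linarith
    then have "1-lipschitz_on {0..1} \<psi>"
      by (intro lipschitz_onI) (auto simp: dist_real_def)
    then have "continuous_on {0..1} \<psi>" by (rule lipschitz_on_continuous_on)
    then show "continuous_on {0..1} \<phi>"
      unfolding \<phi>_def using c by (intro continuous_intros) auto
    show "\<phi> \<in> {0..1} \<rightarrow> {0..1}"
      using mono[of 0] mono[of _ 1] psi0 c by (auto simp: \<phi>_def c_def divide_simps)
    show "\<phi> 0 = 0" "\<phi> 1 = 1" using psi0 c by (auto simp: \<phi>_def c_def)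
  next
    fix a b :: real assume ab: "0 \<le> a \<and> a < b \<and> b \<le> 1"
    then obtain q where q: "q \<in> \<rat>" "a < q" "q < b" using Rats_dense_in_real by blast
    then have "open ({a<..<b} \<inter> T)" "q \<in> {a<..<b} \<inter> T" using T by auto
    then obtain r where r: "r > 0" "cball q r \<subseteq> {a<..<b} \<inter> T" using open_contains_cball by blast
    have sub: "{q-r..q+r} \<subseteq> {a<..<b} \<inter> T" using r by (simp add: cball_eq_atLeastAtMost)
    have "q - r \<in> {q-r..q+r}" "q + r \<in> {q-r..q+r}" using r by auto
    then have qr: "a < q - r" "q + r < b"
      using subsetD[OF sub] by (meson IntD1 greaterThanLessThan_iff)+
    have "\<psi> x = \<psi> (q - r)" if "x \<in> {q-r..q+r}" for x
    proof -
      have "{q-r<..x} \<subseteq> {q-r..q+r}" using that by auto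
      then have "{q-r<..x} - T = {}" using sub by blast
      moreover have "0 \<le> q - r" "q - r \<le> x" using qr that ab by auto
      ultimately have "\<psi> x - \<psi> (q - r) = measure lebesgue ({} :: real set)" using diff[of "q-r" x] by metis
      then show ?thesis by simp
    qed
    then have "\<forall>x\<in>{q-r..q+r}. \<phi> x = \<psi> (q - r) / c" unfolding \<phi>_def by metis
    then have "\<phi> constant_on {q-r..q+r}" unfolding constant_on_def by blast
    then show "\<exists>c d. a \<le> c \<and> c < d \<and> d \<le> b \<and> \<phi> constant_on {c..d}"
      using r qr by (intro exI[of _ "q-r"] exI[of _ "q+r"]) auto
  qed
  moreover have "\<bar>\<phi> t - t\<bar> < e" if "t \<in> {0..1}" for t
  proof -
    have t: "0 \<le> t" "t \<le> 1" using that by auto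
    have p: "0 \<le> \<psi> t" using mono[of 0 t] psi0 t by simp
    have "\<psi> t \<le> \<phi> t" unfolding \<phi>_def using p c by (simp add: divide_simps mult_left_le)
    then have l: "t - \<delta> \<le> \<phi> t" using lower[of t] t by simp
    \<comment> \<open>The upper bound \<open>t + 2 \<delta>\<close> for \<open>\<psi> t / c\<close>, from \<open>\<psi> t \<le> t \<le> 1\<close> and \<open>c \<ge> 1 - \<delta> \<ge> 1/2\<close>\<close>
    have "0 \<le> \<delta> * (2 - t - 2 * \<delta>)" using \<delta> t by (intro mult_nonneg_nonneg) auto
    then have "t \<le> (t + 2 * \<delta>) * (1 - \<delta>)" by (simp add: algebra_simps)
    also have "\<dots> \<le> (t + 2 * \<delta>) * c" using c t \<delta> by (intro mult_left_mono) auto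
    finally have "\<psi> t \<le> (t + 2 * \<delta>) * c" using upper[of t] t by simp
    then have "\<phi> t \<le> t + 2 * \<delta>" unfolding \<phi>_def using c by (simp add: divide_simps)
    with l show ?thesis using \<delta> by linarith
  qed
  ultimately show thesis using that by blast
qed

text \<open>
  A connected open set on which \<open>u\<close> is not constant is mapped onto a set that contains a
  nondegenerate interval, hence an interval \<open>[c,d]\<close> on which \<open>\<phi>\<close> is constant; the preimage of
  \<open>(c,d)\<close> is the required open set. If \<open>u\<close> is constant there, nothing has to be done.
\<close>
lemma generically_constant_staircase:
  assumes X: "locally_connected_space X" and \<phi>: "staircase \<phi>"
    and u: "continuous_map X (top_of_set {0..1}) u"
  shows "generically X (\<lambda>V. (\<phi> \<circ> u) constant_on V)"
  unfolding generically_def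
proof (intro allI impI)
  fix W assume W: "openin X W \<and> W \<noteq> {}"
  then obtain C where C: "openin X C" "connectedin X C" "C \<noteq> {}" "C \<subseteq> W"
    using X unfolding locally_connected_space by blast
  show "\<exists>V. openin X V \<and> V \<noteq> {} \<and> V \<subseteq> W \<and> (\<phi> \<circ> u) constant_on V"
  proof (cases "u constant_on C")
    case True
    then have "(\<phi> \<circ> u) constant_on C" by (auto simp: constant_on_def)
    then show ?thesis using C by blast
  next
    case False
    then obtain x y where xy: "x \<in> C" "y \<in> C" "u x < u y"
      unfolding constant_on_def by (metis linorder_less_linear)
    have "connectedin (top_of_set {0..1}) (u ` C)"
      using connectedin_continuous_map_image[OF u C(2)] .
    then have conn: "connected (u ` C)" and I: "u ` C \<subseteq> {0..1}"
      by (auto simp: connectedin_subtopology)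
    have "0 \<le> u x \<and> u x < u y \<and> u y \<le> 1" using I xy by auto
    then obtain c d where cd: "u x \<le> c" "c < d" "d \<le> u y" "\<phi> constant_on {c..d}"
      using \<phi> unfolding staircase_def by blast
    have "(c + d) / 2 \<in> u ` C"
      by (rule connectedD_interval[OF conn, of "u x" "u y"]) (use xy cd in auto)
    then obtain z where z: "z \<in> C" "u z = (c + d) / 2" by auto
    have u': "continuous_map X euclideanreal u" using u continuous_map_in_subtopology by blast
    define V where "V = C \<inter> {x \<in> topspace X. u x \<in> {c<..<d}}"
    have "openin X V" unfolding V_def
      using C(1) openin_continuous_map_preimage[OF u', of "{c<..<d}"]
      by (intro openin_Int) auto
    moreover have "z \<in> V" using z cd openin_subset[OF C(1)] by (auto simp: V_def field_simps)
    moreover have "(\<phi> \<circ> u) constant_on V"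
      using cd(4) by (force simp: constant_on_def V_def)
    ultimately show ?thesis using C(4) by (intro exI[of _ V]) (auto simp: V_def)
  qed
qed

section \<open>Neighbourhood retracts of the Hilbert cube\<close>

lemma topspace_hilbert_cube: "w \<in> topspace hilbert_cube \<longleftrightarrow> (\<forall>n. w n \<in> {0..1})"
  by (auto simp: hilbert_cube_def PiE_iff)

lemma continuous_map_into_hilbert_cube:
  "continuous_map X hilbert_cube f \<longleftrightarrow> (\<forall>n. continuous_map X (top_of_set {0..1}) (\<lambda>x. f x n))"
  unfolding hilbert_cube_def by (rule continuous_map_componentwise_UNIV)

lemma hilbert_cube_basic_neighbourhood:
  assumes G: "openin hilbert_cube G" and z: "z \<in> G"
  obtains N :: nat and \<eta> :: real where "\<eta> > 0"
    "\<And>w. w \<in> topspace hilbert_cube \<Longrightarrow> (\<forall>n<N. \<bar>w n - z n\<bar> < \<eta>) \<Longrightarrow> w \<in> G"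
proof -
  obtain U where U: "finite {i. U i \<noteq> {0..1}}" "\<And>i. openin (top_of_set {0..1::real}) (U i)"
      "z \<in> Pi\<^sub>E UNIV U" "Pi\<^sub>E UNIV U \<subseteq> G"
    using G z unfolding hilbert_cube_def openin_product_topology_alt by fastforce
  have "\<exists>r>0. \<forall>t\<in>{0..1}. \<bar>t - z i\<bar> < r \<longrightarrow> t \<in> U i" for i
  proof -
    have "z i \<in> U i" using U(3) by auto
    then show ?thesis
      using U(2)[of i] unfolding openin_euclidean_subtopology_iff dist_real_def by blast
  qed
  then obtain r where r: "\<And>i. r i > 0" "\<And>i t. t \<in> {0..1} \<Longrightarrow> \<bar>t - z i\<bar> < r i \<Longrightarrow> t \<in> U i"
    by metis
  obtain N where N: "\<And>i. U i \<noteq> {0..1} \<Longrightarrow> i < N"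
    using U(1) by (auto simp: finite_nat_set_iff_bounded)
  define \<eta> where "\<eta> = Min (insert 1 (r ` {..<N}))"
  have "\<eta> > 0" unfolding \<eta>_def using r(1) by auto
  moreover have "w \<in> G" if w: "w \<in> topspace hilbert_cube" "\<forall>n<N. \<bar>w n - z n\<bar> < \<eta>" for w
  proof -
    have "w i \<in> U i" for i
    proof (cases "i < N")
      case True
      then have "\<eta> \<le> r i" unfolding \<eta>_def by (intro Min_le) auto
      then show ?thesis using w True r(2)[of "w i" i] by (force simp: topspace_hilbert_cube)
    next
      case False
      then have "U i = {0..1}" using N by blast
      then show ?thesis using w(1) by (simp add: topspace_hilbert_cube)
    qed
    then show ?thesis using U(4) by auto
  qed
  ultimately show thesis using that by blast
qed

lemma openin_finitely_many_conditions:
  fixes N :: nat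
  assumes "\<And>n. n < N \<Longrightarrow> openin X {y \<in> topspace X. P n y}"
  shows "openin X {y \<in> topspace X. \<forall>n<N. P n y}"
  using assms
proof (induction N)
  case (Suc N)
  have "{y \<in> topspace X. \<forall>n<Suc N. P n y} = {y \<in> topspace X. \<forall>n<N. P n y} \<inter> {y \<in> topspace X. P N y}"
    by (auto simp: less_Suc_eq)
  then show ?case using Suc by auto
qed auto

context Metric_space
begin

text \<open>
  Think of \<open>X\<close> as embedded by \<open>e\<close>, and of \<open>p\<close> as a retraction of its neighbourhood \<open>V\<close>. Each point
  of \<open>X\<close> has a basic neighbourhood, restricting finitely many coordinates, which \<open>p\<close> maps into a
  small ball; compactness makes the number \<open>N\<close> of coordinates and the tolerance \<open>\<eta>\<close> uniform.
\<close>
lemma neighbourhood_retraction_uniform: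
  assumes comp: "compact_space mtopology" and e: "continuous_map mtopology hilbert_cube e"
    and V: "openin hilbert_cube V" "e ` M \<subseteq> V"
    and p: "continuous_map (subtopology hilbert_cube V) mtopology p" "\<And>x. x \<in> M \<Longrightarrow> p (e x) = x"
    and \<epsilon>: "\<epsilon> > 0"
  obtains N :: nat and \<eta> :: real where "\<eta> > 0"
    "\<And>y w. y \<in> M \<Longrightarrow> w \<in> topspace hilbert_cube \<Longrightarrow> (\<forall>n<N. \<bar>w n - e y n\<bar> < \<eta>) \<Longrightarrow>
       w \<in> V \<and> d (p w) y < \<epsilon>"
proof -
  have "\<exists>N \<eta>. \<eta> > 0 \<and> (\<forall>w\<in>topspace hilbert_cube. (\<forall>n<N. \<bar>w n - e x n\<bar> < 2 * \<eta>) \<longrightarrow>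
          w \<in> V \<and> p w \<in> mball x (\<epsilon>/2))" if x: "x \<in> M" for x
  proof -
    have "openin (subtopology hilbert_cube V)
        {w \<in> topspace (subtopology hilbert_cube V). p w \<in> mball x (\<epsilon>/2)}"
      by (rule openin_continuous_map_preimage[OF p(1)]) auto
    then have "openin hilbert_cube
        {w \<in> topspace (subtopology hilbert_cube V). p w \<in> mball x (\<epsilon>/2)}"
      using V(1) openin_trans_full by blast
    moreover have "e x \<in> {w \<in> topspace (subtopology hilbert_cube V). p w \<in> mball x (\<epsilon>/2)}"
      using V x p(2)[OF x] \<epsilon> openin_subset by fastforce
    ultimately obtain N \<eta> where "\<eta> > 0" "\<And>w. w \<in> topspace hilbert_cube \<Longrightarrow> (\<forall>n<N. \<bar>w n - e x n\<bar> < \<eta>)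
        \<Longrightarrow> w \<in> {w \<in> topspace (subtopology hilbert_cube V). p w \<in> mball x (\<epsilon>/2)}"
      by (rule hilbert_cube_basic_neighbourhood) blast
    \<comment> \<open>Half of the tolerance is kept for moving \<open>x\<close> to a nearby point \<open>y\<close> below.\<close>
    then show ?thesis by (intro exI[of _ N] exI[of _ "\<eta>/2"]) auto
  qed
  then obtain N \<eta> where \<eta>: "\<And>x. x \<in> M \<Longrightarrow> \<eta> x > 0"
    and N: "\<And>x w. x \<in> M \<Longrightarrow> w \<in> topspace hilbert_cube \<Longrightarrow> (\<forall>n<N x. \<bar>w n - e x n\<bar> < 2 * \<eta> x) \<Longrightarrow>
          w \<in> V \<and> p w \<in> mball x (\<epsilon>/2)"
    by metis
  define B where "B x = mball x (\<epsilon>/2) \<inter> {y \<in> topspace mtopology. \<forall>n<N x. \<bar>e y n - e x n\<bar> < \<eta> x}" for x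
  have opB: "openin mtopology (B x)" for x
    unfolding B_def
  proof (intro openin_Int openin_mball openin_finitely_many_conditions)
    fix n
    have "continuous_map mtopology euclideanreal (\<lambda>y. e y n)"
      using e continuous_map_in_subtopology unfolding continuous_map_into_hilbert_cube by blast
    from openin_continuous_map_preimage[OF this, of "ball (e x n) (\<eta> x)"]
    show "openin mtopology {y \<in> topspace mtopology. \<bar>e y n - e x n\<bar> < \<eta> x}"
      by (simp add: dist_real_def abs_minus_commute)
  qed
  have "\<exists>\<F>. finite \<F> \<and> \<F> \<subseteq> B ` M \<and> topspace mtopology \<subseteq> \<Union>\<F>"
    using comp unfolding compact_space_alt
  proof (elim allE impE)
    show "Ball (B ` M) (openin mtopology) \<and> topspace mtopology \<subseteq> \<Union>(B ` M)"
      using opB \<eta> \<epsilon> by (auto simp: B_def)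
  qed
  then obtain K where K: "finite K" "K \<subseteq> M" "M \<subseteq> \<Union>(B ` K)"
    by (metis finite_subset_image topspace_mtopology)
  define \<eta>' where "\<eta>' = Min (insert 1 (\<eta> ` K))"
  define N' where "N' = Max (insert 0 (N ` K))"
  have "\<eta>' > 0" unfolding \<eta>'_def using K \<eta> by auto
  moreover have "w \<in> V \<and> d (p w) y < \<epsilon>"
    if y: "y \<in> M" and w: "w \<in> topspace hilbert_cube" and near: "\<forall>n<N'. \<bar>w n - e y n\<bar> < \<eta>'" for y w
  proof -
    obtain x where x: "x \<in> K" "y \<in> B x" using K y by blast
    have le: "\<eta>' \<le> \<eta> x" "N x \<le> N'"
      unfolding \<eta>'_def N'_def using x K by (auto intro: Min_le Max_ge)
    have "\<forall>n<N x. \<bar>w n - e x n\<bar> < 2 * \<eta> x"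
    proof (intro allI impI)
      fix n assume n: "n < N x"
      have "\<bar>w n - e y n\<bar> < \<eta> x" 
        using near[rule_format, of n] n le by linarith
      moreover have "\<bar>e y n - e x n\<bar> < \<eta> x" using x(2) n by (auto simp: B_def)
      ultimately show "\<bar>w n - e x n\<bar> < 2 * \<eta> x" by linarith
    qed
    then have "w \<in> V" "p w \<in> mball x (\<epsilon>/2)" using N x K w by blast+
    moreover have "y \<in> mball x (\<epsilon>/2)" using x by (auto simp: B_def)
    ultimately show ?thesis
      using triangle[of "p w" x y] commute[of "p w" x] by auto
  qed
  ultimately show thesis using that by blast
qed

text \<open>
  The map is \<open>p \<circ> g\<close>, where \<open>g\<close> perturbs the embedding \<open>e\<close>: it applies \<open>\<phi>\<close> to the first \<open>N\<close>
  coordinates and cuts off the others. As \<open>g\<close> is determined by the finitely many functions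
  \<open>\<phi> \<circ> (\<lambda>x. e x n)\<close>, all of them are constant on suitable open subsets of any given open set.
\<close>
lemma ANR_identity_approximation:
  assumes comp: "compact_space mtopology" and lc: "locally_connected_space mtopology"
    and ANR: "compact_ANR mtopology" and \<epsilon>: "\<epsilon> > 0"
  obtains h where "continuous_map mtopology mtopology h" "generically mtopology (\<lambda>V. h constant_on V)"
    "\<And>x. x \<in> M \<Longrightarrow> d (h x) x < \<epsilon>"
proof -
  obtain A U where U: "neighbourhood_of hilbert_cube A U"
      and ret: "A retract_of_space (subtopology hilbert_cube U)"
      and hom: "mtopology homeomorphic_space (subtopology hilbert_cube A)"
    using ANR unfolding compact_ANR_def by blast
  obtain V where V: "openin hilbert_cube V" "A \<subseteq> V" "V \<subseteq> U"
    using U unfolding neighbourhood_of_def by blast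
  obtain r where r: "continuous_map (subtopology hilbert_cube U) (subtopology (subtopology hilbert_cube U) A) r"
      "\<And>x. x \<in> A \<Longrightarrow> r x = x"
    using ret unfolding retract_of_space_def by blast
  obtain e e' where e: "continuous_map mtopology (subtopology hilbert_cube A) e"
      and e': "continuous_map (subtopology hilbert_cube A) mtopology e'"
      and inv: "\<And>x. x \<in> M \<Longrightarrow> e' (e x) = x"
    using hom unfolding homeomorphic_space_def homeomorphic_maps_def by auto
  have AU: "U \<inter> A = A" using V by blast
  have rV: "continuous_map (subtopology hilbert_cube V) (subtopology hilbert_cube A) r"
    using continuous_map_from_subtopology_mono[OF r(1) V(3)] by (simp add: subtopology_subtopology AU)
  define p where "p = e' \<circ> r"
  have p: "continuous_map (subtopology hilbert_cube V) mtopology p"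
    unfolding p_def by (rule continuous_map_compose[OF rV e'])
  have eA: "e x \<in> A" if "x \<in> M" for x
    using e that by (auto simp: continuous_map_in_subtopology)
  have pe: "p (e x) = x" if "x \<in> M" for x
    using inv r(2) eA that by (simp add: p_def)
  have eQ: "continuous_map mtopology hilbert_cube e" using e by (simp add: continuous_map_in_subtopology)
  have eV: "e ` M \<subseteq> V" using eA V(2) by blast
  obtain N :: nat and \<eta> where \<eta>: "\<eta> > 0"
    and N: "\<And>y w. y \<in> M \<Longrightarrow> w \<in> topspace hilbert_cube \<Longrightarrow> (\<forall>n<N. \<bar>w n - e y n\<bar> < \<eta>) \<Longrightarrow>
       w \<in> V \<and> d (p w) y < \<epsilon>"
    using neighbourhood_retraction_uniform[OF comp eQ V(1) eV p pe \<epsilon>] by metis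
  obtain \<phi> where \<phi>: "staircase \<phi>" "\<And>t. t \<in> {0..1} \<Longrightarrow> \<bar>\<phi> t - t\<bar> < \<eta>"
    by (rule staircase_close_to_identity[OF \<eta>]) blast
  define g where "g x = (\<lambda>n. if n < N then \<phi> (e x n) else 0)" for x
  have en: "continuous_map mtopology (top_of_set {0..1}) (\<lambda>x. e x n)" for n
    using eQ unfolding continuous_map_into_hilbert_cube by blast
  have \<phi>c: "continuous_map (top_of_set {0..1}) (top_of_set {0..1}) \<phi>"
    using \<phi>(1) unfolding staircase_def by (auto simp: continuous_map_in_subtopology)
  have g: "continuous_map mtopology hilbert_cube g"
    unfolding continuous_map_into_hilbert_cube
  proof
    fix n
    show "continuous_map mtopology (top_of_set {0..1}) (\<lambda>x. g x n)"
      using continuous_map_compose[OF en[of n] \<phi>c] by (cases "n < N") (auto simp: g_def o_def)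
  qed
  have gN: "g x \<in> V \<and> d (p (g x)) x < \<epsilon>" if "x \<in> M" for x
  proof (rule N[OF that])
    show "g x \<in> topspace hilbert_cube"
      using g that by (metis continuous_map_image_subset_topspace image_subset_iff topspace_mtopology)
    have "e x n \<in> {0..1}" for n
      using eQ that by (metis continuous_map_image_subset_topspace image_subset_iff topspace_mtopology
          topspace_hilbert_cube)
    then show "\<forall>n<N. \<bar>g x n - e x n\<bar> < \<eta>" using \<phi>(2) by (auto simp: g_def)
  qed
  show thesis
  proof (rule that[of "p \<circ> g"])
    show "continuous_map mtopology mtopology (p \<circ> g)"
      using g gN by (intro continuous_map_compose[OF _ p]) (auto simp: continuous_map_in_subtopology)
    have "generically mtopology (\<lambda>V. \<forall>n\<in>{..<N}. (\<phi> \<circ> (\<lambda>x. e x n)) constant_on V)"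
      by (intro generically_ball_finite generically_constant_staircase lc \<phi>(1) en)
        (auto intro: constant_on_subset)
    then show "generically mtopology (\<lambda>V. (p \<circ> g) constant_on V)"
    proof (rule generically_mono)
      fix V assume "V \<noteq> {}" and V: "\<forall>n\<in>{..<N}. (\<phi> \<circ> (\<lambda>x. e x n)) constant_on V"
      then obtain x where x: "x \<in> V" by blast
      have "g y = g x" if "y \<in> V" for y
      proof
        fix n show "g y n = g x n"
        proof (cases "n < N")
          case True
          then have "(\<phi> \<circ> (\<lambda>x. e x n)) constant_on V" using V by blast
          then have "\<phi> (e y n) = \<phi> (e x n)" using x that unfolding constant_on_def comp_def by metis
          then show ?thesis by (simp add: g_def)
        qed (simp add: g_def)
      qed
      then show "(p \<circ> g) constant_on V" unfolding constant_on_def comp_def by metis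
    qed
    show "d ((p \<circ> g) x) x < \<epsilon>" if "x \<in> M" for x using gN that by simp
  qed
qed

end

section \<open>Uniform local path connectedness\<close>

lemma ex_dyadic_less:
  fixes c e :: real
  assumes "e > 0"
  shows "\<exists>n::nat. c / 2 ^ n < e"
proof -
  obtain n where "\<bar>c\<bar> / e < 2 ^ n" using real_arch_pow[of 2 "\<bar>c\<bar> / e"] by auto
  then have "\<bar>c\<bar> < e * 2 ^ n" using assms by (simp add: field_simps)
  then have "c / 2 ^ n < e" by (simp add: field_simps)
  then show ?thesis ..
qed

context Metric_space
begin

text \<open>
  A Lebesgue number for the cover by small connected open sets.
\<close>
lemma uniformly_locally_connected:
  assumes comp: "compact_space mtopology" and lc: "locally_connected_space mtopology" and \<epsilon>: "\<epsilon> > 0"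
  obtains \<delta> where "\<delta> > 0"
    "\<And>x y. x \<in> M \<Longrightarrow> y \<in> M \<Longrightarrow> d x y < \<delta> \<Longrightarrow>
       \<exists>C. connectedin mtopology C \<and> x \<in> C \<and> y \<in> C \<and> C \<subseteq> mball x \<epsilon>"
proof -
  define \<C> where "\<C> = {U. openin mtopology U \<and> connectedin mtopology U \<and> (\<exists>z. U \<subseteq> mball z (\<epsilon>/2))}"
  have "M \<subseteq> \<Union>\<C>"
  proof
    fix x assume "x \<in> M"
    then have "openin mtopology (mball x (\<epsilon>/2))" "x \<in> mball x (\<epsilon>/2)" using \<epsilon> by auto
    then obtain U where "openin mtopology U" "connectedin mtopology U" "x \<in> U" "U \<subseteq> mball x (\<epsilon>/2)"
      using lc unfolding locally_connected_space by meson
    then show "x \<in> \<Union>\<C>" unfolding \<C>_def by blast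
  qed
  moreover have "compactin mtopology M" using comp by (simp add: compact_space_def)
  moreover have "openin mtopology U" if "U \<in> \<C>" for U using that by (simp add: \<C>_def)
  ultimately obtain \<delta> where \<delta>: "\<delta> > 0" "\<And>x. x \<in> M \<Longrightarrow> \<exists>U\<in>\<C>. mball x \<delta> \<subseteq> U"
    using lebesgue_number[of M \<C>] by metis
  have "\<exists>C. connectedin mtopology C \<and> x \<in> C \<and> y \<in> C \<and> C \<subseteq> mball x \<epsilon>"
    if xy: "x \<in> M" "y \<in> M" "d x y < \<delta>" for x y
  proof -
    obtain U where U: "U \<in> \<C>" "mball x \<delta> \<subseteq> U" using \<delta>(2) xy by blast
    then obtain z where z: "U \<subseteq> mball z (\<epsilon>/2)" unfolding \<C>_def by blast
    have x: "x \<in> U" and y: "y \<in> U" using U xy \<delta>(1) by auto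
    have "U \<subseteq> mball x \<epsilon>"
    proof
      fix c assume "c \<in> U"
      then have "c \<in> mball z (\<epsilon>/2)" "x \<in> mball z (\<epsilon>/2)" using z x by auto
      then show "c \<in> mball x \<epsilon>" using triangle[of x z c] commute[of x z] by auto
    qed
    then show ?thesis using U(1) x y unfolding \<C>_def by blast
  qed
  then show thesis using that \<delta>(1) by blast
qed

text \<open>
  The points of \<open>C\<close> that can be reached from \<open>a\<close> in \<open>C\<close> by finitely many steps shorter than \<open>\<eta>\<close> form a
  relatively clopen set. The chain is continued by the constant \<open>b\<close>, so that finitely many chains can
  be given the same length.
\<close>
lemma connectedin_chain:
  assumes C: "connectedin mtopology C" and ab: "a \<in> C" "b \<in> C" and \<eta>: "\<eta> > 0"
  obtains c :: "nat \<Rightarrow> 'a" and N where "c 0 = a" "\<And>i. c i \<in> C"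
    "\<And>i. d (c i) (c (Suc i)) < \<eta>" "\<And>i. i \<ge> N \<Longrightarrow> c i = b"
proof -
  have CM: "C \<subseteq> M" using connectedin_subset_topspace[OF C] by simp
  define reach where "reach b \<longleftrightarrow> (\<exists>c N. c 0 = a \<and> (\<forall>i. c i \<in> C) \<and> (\<forall>i. d (c i) (c (Suc i)) < \<eta>) \<and>
    (\<forall>i\<ge>N. c i = b))" for b
  have reach_a: "reach a"
    unfolding reach_def using ab \<eta> CM by (intro exI[of _ "\<lambda>_. a"] exI[of _ 0]) auto
  have step: "reach z" if y: "reach y" and z: "z \<in> C" "d y z < \<eta>" for y z
  proof -
    obtain c N where c: "c 0 = a" "\<And>i. c i \<in> C" "\<And>i. d (c i) (c (Suc i)) < \<eta>" "\<And>i::nat. i \<ge> N \<Longrightarrow> c i = y"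
      using y unfolding reach_def by blast
    define c' where "c' i = (if i \<le> N then c i else z)" for i
    have "d (c' i) (c' (Suc i)) < \<eta>" for i
      using c(3)[of i] c(4)[of i] z CM \<eta> by (cases i N rule: linorder_cases) (auto simp: c'_def)
    then show ?thesis
      unfolding reach_def using c z
      by (intro exI[of _ c'] exI[of _ "Suc N"]) (auto simp: c'_def)
  qed
  define E1 where "E1 = (\<Union>y\<in>{y\<in>C. reach y}. mball y \<eta>)"
  define E2 where "E2 = (\<Union>y\<in>{y\<in>C. \<not> reach y}. mball y \<eta>)"
  have op: "openin mtopology E1" "openin mtopology E2" unfolding E1_def E2_def by auto
  have cover: "C \<subseteq> E1 \<union> E2" unfolding E1_def E2_def using CM \<eta> by auto
  have "reach z" if "z \<in> C" "z \<in> E1" for z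
    using that step unfolding E1_def by auto
  moreover have "\<not> reach z" if "z \<in> C" "z \<in> E2" for z
    using that step unfolding E2_def by (auto simp: commute)
  ultimately have "E1 \<inter> E2 \<inter> C = {}" by blast
  moreover have "E1 \<inter> C \<noteq> {}" using reach_a ab CM \<eta> unfolding E1_def by auto
  ultimately have "E2 \<inter> C = {}" using C op cover unfolding connectedin by blast
  then have "reach b" using ab CM \<eta> unfolding E2_def by auto
  then show thesis unfolding reach_def using that by blast
qed

text \<open>
  One step of the construction of a path: between consecutive points of a chain \<open>f\<close>, insert chains
  with shorter steps that stay near the left point. All inserted chains get the same number
  \<open>k\<close> of steps, so the new point with index \<open>m\<close> belongs to the old one with index \<open>m div k\<close>.
\<close>
lemma chain_refinement:
  assumes link: "\<forall>y\<in>M. \<forall>z\<in>M. d y z < \<alpha> \<longrightarrow>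
       (\<exists>C. connectedin mtopology C \<and> y \<in> C \<and> z \<in> C \<and> C \<subseteq> mball y \<rho>)"
    and \<rho>: "\<rho> > 0" and \<beta>: "\<beta> > 0"
    and f: "\<And>i. f i \<in> M" "\<forall>i\<ge>K. f i = b" "\<And>i. d (f i) (f (Suc i)) < \<alpha>"
  obtains k :: nat and g where "k > 0" "g 0 = f 0" "\<And>m. g m \<in> M" "\<And>m. m \<ge> K * k \<Longrightarrow> g m = b"
    "\<And>m. d (g m) (g (Suc m)) < \<beta>" "\<And>m. d (f (m div k)) (g m) < \<rho>"
proof -
  have "\<exists>c N. c 0 = f i \<and> (\<forall>j. c j \<in> mball (f i) \<rho>) \<and> (\<forall>j. d (c j) (c (Suc j)) < \<beta>) \<and>
        (\<forall>j\<ge>N. c j = f (Suc i)) \<and> (i \<ge> K \<longrightarrow> N = 0)" for i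
  proof (cases "i \<ge> K")
    case True
    then have "f i = b" "f (Suc i) = b" using f(2) by auto
    then show ?thesis using f(1)[of i] \<rho> \<beta> by (intro exI[of _ "\<lambda>_. b"] exI[of _ 0]) auto
  next
    case False
    obtain C where C: "connectedin mtopology C" "f i \<in> C" "f (Suc i) \<in> C" "C \<subseteq> mball (f i) \<rho>"
      using link f(1,3) by blast
    obtain c :: "nat \<Rightarrow> 'a" and N where "c 0 = f i" "\<And>j. c j \<in> C" "\<And>j. d (c j) (c (Suc j)) < \<beta>"
      "\<And>j. j \<ge> N \<Longrightarrow> c j = f (Suc i)"
      using connectedin_chain[OF C(1-3) \<beta>] by metis
    then show ?thesis using C(4) False by (intro exI[of _ c] exI[of _ N]) blast
  qed
  then obtain c N where c0: "\<And>i. c i 0 = f i" and cb: "\<And>i j. c i j \<in> mball (f i) \<rho>"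
    and cs: "\<And>i j. d (c i j) (c i (Suc j)) < \<beta>" and cN: "\<And>i (j::nat). j \<ge> N i \<Longrightarrow> c i j = f (Suc i)"
    and NK: "\<And>i. i \<ge> K \<Longrightarrow> N i = 0"
    by metis
  define k where "k = Suc (Max (insert 0 (N ` {..<K})))"
  have Nk: "N i \<le> k" for i
  proof (cases "i < K")
    case True
    then have "N i \<le> Max (insert 0 (N ` {..<K}))" by (intro Max_ge) auto
    then show ?thesis by (simp add: k_def)
  qed (use NK in auto)
  define g where "g m = c (m div k) (m mod k)" for m
  have k: "k > 0" by (simp add: k_def)
  show thesis
  proof (rule that[of k g])
    show "k > 0" by (rule k)
    show "g 0 = f 0" by (simp add: g_def c0)
    show "g m \<in> M" for m using cb[of "m div k" "m mod k"] by (auto simp: g_def)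
    show "g m = b" if "m \<ge> K * k" for m
    proof -
      have "m div k \<ge> K" using that k by (simp add: less_eq_div_iff_mult_less_eq)
      then show ?thesis using cN[of "m div k" "m mod k"] NK f(2) by (simp add: g_def)
    qed
    show "d (g m) (g (Suc m)) < \<beta>" for m
    proof (cases "Suc (m mod k) = k")
      case True
      then have "g (Suc m) = f (Suc (m div k))"
        by (simp add: g_def div_Suc mod_Suc c0)
      also have "\<dots> = c (m div k) (Suc (m mod k))" using cN[OF Nk] True by simp
      finally show ?thesis using cs by (simp add: g_def)
    next
      case False
      then have "g (Suc m) = c (m div k) (Suc (m mod k))" by (simp add: g_def div_Suc mod_Suc)
      then show ?thesis using cs by (simp add: g_def)
    qed
    show "d (f (m div k)) (g m) < \<rho>" for m
      using cb[of "m div k" "m mod k"] by (simp add: g_def)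
  qed
qed

text \<open>
  The chain \<open>f n\<close> defines the step function \<open>F n\<close> that has the value \<open>f n i\<close> on the interval between
  \<open>i / K n\<close> and \<open>(i + 1) / K n\<close>. These functions converge uniformly, with error at most
  \<open>2 r / 2 ^ n\<close>, and the jumps of \<open>F n\<close> are below \<open>r / 2 ^ n\<close>; so the limit is continuous.
\<close>
lemma path_of_refining_chains:
  fixes K :: "nat \<Rightarrow> nat" and f :: "nat \<Rightarrow> nat \<Rightarrow> 'a" and r :: real
  assumes complete: mcomplete
    and K: "\<And>n. K n > 0" and f: "\<And>n i. f n i \<in> M" "\<And>n. f n 0 = x" "\<And>n. \<forall>i\<ge>K n. f n i = y"
    and step: "\<And>n i. d (f n i) (f n (Suc i)) < r / 2 ^ n"
    and refine: "\<And>n. \<exists>k>0. K (Suc n) = K n * k \<and> (\<forall>m. d (f n (m div k)) (f (Suc n) m) < r / 2 ^ n)"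
  obtains g where "continuous_map (top_of_set {0..1::real}) mtopology g" "g 0 = x" "g 1 = y"
    "\<And>t. t \<in> {0..1} \<Longrightarrow> \<exists>i. d (f 0 i) (g t) \<le> 2 * r"
proof -
  define F where "F n t = f n (nat \<lfloor>real (K n) * t\<rfloor>)" for n t
  have r: "r > 0" using le_less_trans[OF nonneg step[of 0 0]] by simp
  have FM: "F n t \<in> M" for n t by (simp add: F_def f)
  have next_level: "d (F n t) (F (Suc n) t) < r / 2 ^ n" if t: "t \<ge> 0" for n t
  proof -
    obtain k where k: "k > 0" "K (Suc n) = K n * k" "\<And>m. d (f n (m div k)) (f (Suc n) m) < r / 2 ^ n"
      using refine[of n] by blast
    have "\<lfloor>real (K (Suc n)) * t\<rfloor> div int k = \<lfloor>(real (K (Suc n)) * t) / real_of_int (int k)\<rfloor>"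
      by (rule floor_divide_real_eq_div[symmetric]) simp
    also have "(real (K (Suc n)) * t) / real_of_int (int k) = real (K n) * t"
      using k by (simp add: field_simps)
    finally have "nat \<lfloor>real (K (Suc n)) * t\<rfloor> div k = nat \<lfloor>real (K n) * t\<rfloor>"
      using t by (metis nat_div_distrib nat_int of_nat_0_le_iff zero_le_floor mult_nonneg_nonneg)
    then show ?thesis using k(3)[of "nat \<lfloor>real (K (Suc n)) * t\<rfloor>"] by (simp add: F_def)
  qed
  have later: "d (F n t) (F (n + p) t) \<le> 2 * r / 2 ^ n - 2 * r / 2 ^ (n + p)" if t: "t \<ge> 0" for n p t
  proof (induction p)
    case 0
    then show ?case using FM by simp
  next
    case (Suc p)
    have "d (F n t) (F (n + Suc p) t) \<le> d (F n t) (F (n + p) t) + d (F (n + p) t) (F (Suc (n + p)) t)"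
      using triangle[OF FM FM FM] by simp
    also have "\<dots> \<le> 2 * r / 2 ^ n - 2 * r / 2 ^ (n + p) + r / 2 ^ (n + p)"
      using Suc next_level[OF t, of "n + p"] by linarith
    also have "\<dots> = 2 * r / 2 ^ n - 2 * r / 2 ^ (n + Suc p)" by (simp add: field_simps)
    finally show ?case .
  qed
  have later': "d (F n t) (F m t) \<le> 2 * r / 2 ^ n" if "t \<ge> 0" "n \<le> m" for n m t
    using later[OF that(1), of n "m - n"] that r by (smt (verit) divide_nonneg_pos le_add_diff_inverse zero_less_power)
  have "\<exists>l. limitin mtopology (\<lambda>n. F n t) l sequentially" if t: "t \<ge> 0" for t
  proof -
    have "MCauchy (\<lambda>n. F n t)"
      unfolding MCauchy_def
    proof (intro conjI allI impI)
      show "range (\<lambda>n. F n t) \<subseteq> M" using FM by auto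
      fix \<epsilon> :: real assume "\<epsilon> > 0"
      then obtain N where N: "4 * r / 2 ^ N < \<epsilon>" using ex_dyadic_less by blast
      have "d (F n t) (F n' t) < \<epsilon>" if "N \<le> n" "N \<le> n'" for n n'
        using triangle[of "F n t" "F N t" "F n' t"] FM later'[OF t that(1)] later'[OF t that(2)] N
          commute[of "F n t" "F N t"] by simp
      then show "\<exists>N. \<forall>n n'. N \<le> n \<longrightarrow> N \<le> n' \<longrightarrow> d (F n t) (F n' t) < \<epsilon>" by blast
    qed
    then show ?thesis using complete unfolding mcomplete_def by blast
  qed
  then obtain g where g: "\<And>t. t \<ge> 0 \<Longrightarrow> limitin mtopology (\<lambda>n. F n t) (g t) sequentially" by metis
  have gM: "g t \<in> M" if "t \<ge> 0" for t using g[OF that] limitin_mspace by blast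
  have Fg: "d (F n t) (g t) \<le> 2 * r / 2 ^ n" if t: "t \<ge> 0" for n t
  proof (rule field_le_epsilon)
    fix e :: real assume "e > 0"
    then have "\<forall>\<^sub>F m in sequentially. F m t \<in> M \<and> d (F m t) (g t) < e"
      using g[OF t] unfolding limitin_metric by blast
    then obtain m where m: "m \<ge> n" "d (F m t) (g t) < e"
      unfolding eventually_sequentially by (metis le_add1 le_add2)
    show "d (F n t) (g t) \<le> 2 * r / 2 ^ n + e"
      using triangle[of "F n t" "F m t" "g t"] FM gM[OF t] later'[OF t m(1)] m(2) by simp
  qed
  have fixed: "g t = z" if t: "t \<ge> 0" and z: "\<And>n. F n t = z" for t z
  proof (rule ccontr)
    assume "g t \<noteq> z"
    moreover have "z \<in> M" using FM[of 0 t] z by simp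
    ultimately have "d z (g t) > 0" using gM[OF t] by simp
    then obtain n where "2 * r / 2 ^ n < d z (g t)" using ex_dyadic_less by blast
    then show False using Fg[OF t, of n] z by simp
  qed
  have "uniformly_continuous_map (submetric euclidean_metric {0..1}) (metric (M,d)) g"
    unfolding uniformly_continuous_map_def
  proof (intro conjI allI impI)
    show "g \<in> mspace (submetric euclidean_metric {0..1}) \<rightarrow> mspace (metric (M,d))"
      using gM by auto
    fix \<epsilon> :: real assume "\<epsilon> > 0"
    then obtain n where n: "5 * r / 2 ^ n < \<epsilon>" using ex_dyadic_less by blast
    have close: "d (g t) (g s) < \<epsilon>" if st: "s \<in> {0..1}" "t \<in> {0..1}" "\<bar>t - s\<bar> < 1 / real (K n)" for s t
    proof -
      have "\<bar>real (K n) * t - real (K n) * s\<bar> = real (K n) * \<bar>t - s\<bar>"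
        by (simp add: abs_mult right_diff_distrib[symmetric])
      also have "\<dots> < 1" using st(3) K[of n] by (simp add: field_simps)
      finally have "\<bar>\<lfloor>real (K n) * t\<rfloor> - \<lfloor>real (K n) * s\<rfloor>\<bar> \<le> 1" by linarith
      then consider "nat \<lfloor>real (K n) * t\<rfloor> = nat \<lfloor>real (K n) * s\<rfloor>"
        | "nat \<lfloor>real (K n) * t\<rfloor> = Suc (nat \<lfloor>real (K n) * s\<rfloor>)"
        | "nat \<lfloor>real (K n) * s\<rfloor> = Suc (nat \<lfloor>real (K n) * t\<rfloor>)"
        by linarith
      then have "d (F n t) (F n s) < r / 2 ^ n"
        using step f r by cases (auto simp: F_def commute)
      moreover have "d (g t) (g s) \<le> d (F n t) (g t) + d (F n t) (F n s) + d (F n s) (g s)"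
        using triangle[of "g t" "F n t" "g s"] triangle[of "F n t" "F n s" "g s"] st FM gM
          commute[of "g t" "F n t"] by simp
      ultimately show ?thesis using Fg[of t n] Fg[of s n] st n by simp
    qed
    show "\<exists>\<delta>>0. \<forall>s\<in>mspace (submetric euclidean_metric {0..1}). \<forall>t\<in>mspace (submetric euclidean_metric {0..1}).
        mdist (submetric euclidean_metric {0..1}) t s < \<delta> \<longrightarrow> mdist (metric (M,d)) (g t) (g s) < \<epsilon>"
      using close K[of n] by (intro exI[of _ "1 / real (K n)"]) (auto simp: dist_real_def)
  qed
  then have "continuous_map (top_of_set {0..1}) mtopology g"
    by (metis uniformly_continuous_imp_continuous_map mtopology_of mtopology_of_submetric mtopology_of_euclidean)
  moreover have "g 0 = x" by (rule fixed) (auto simp: F_def f)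
  moreover have "g 1 = y" by (rule fixed) (auto simp: F_def f)
  moreover have "\<exists>i. d (f 0 i) (g t) \<le> 2 * r" if "t \<in> {0..1}" for t
    using Fg[of t 0] that by (auto simp: F_def)
  ultimately show thesis by (rule that)
qed

text \<open>
  Start with the chain consisting of \<open>x\<close> and \<open>y\<close> and refine it forever. If consecutive points at
  level \<open>n\<close> are closer than \<open>\<delta> n\<close>, then they lie in a connected set of size about \<open>r / 2 ^ n\<close>, in which
  a chain with steps below \<open>\<delta> (n + 1)\<close> joins them.
\<close>
lemma uniformly_locally_path_connected:
  assumes comp: "compact_space mtopology" and lc: "locally_connected_space mtopology" and \<epsilon>: "\<epsilon> > 0"
  obtains \<delta> where "\<delta> > 0"
    "\<And>x y. x \<in> M \<Longrightarrow> y \<in> M \<Longrightarrow> d x y < \<delta> \<Longrightarrow>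
       \<exists>g. continuous_map (top_of_set {0..1::real}) mtopology g \<and> g 0 = x \<and> g 1 = y \<and>
           (\<forall>t\<in>{0..1}. d x (g t) < \<epsilon>)"
proof -
  \<comment> \<open>Points of the path are within \<open>2 r\<close> of \<open>x\<close> or \<open>y\<close>, and \<open>y\<close> is within \<open>r\<close> of \<open>x\<close>; so \<open>3 r < \<epsilon>\<close> suffices.\<close>
  define r where "r = \<epsilon> / 4"
  have r: "r > 0" using \<epsilon> by (simp add: r_def)
  have "\<exists>\<delta>>0. \<delta> \<le> r / 2 ^ n \<and> (\<forall>x\<in>M. \<forall>y\<in>M. d x y < \<delta> \<longrightarrow>
       (\<exists>C. connectedin mtopology C \<and> x \<in> C \<and> y \<in> C \<and> C \<subseteq> mball x (r / 2 ^ n)))" for n :: nat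
  proof -
    have "r / 2 ^ n > 0" using r by simp
    then obtain \<delta> where "\<delta> > 0" "\<And>x y. x \<in> M \<Longrightarrow> y \<in> M \<Longrightarrow> d x y < \<delta> \<Longrightarrow>
       \<exists>C. connectedin mtopology C \<and> x \<in> C \<and> y \<in> C \<and> C \<subseteq> mball x (r / 2 ^ n)"
      using uniformly_locally_connected[OF comp lc] by metis
    then show ?thesis using r by (intro exI[of _ "min \<delta> (r / 2 ^ n)"]) auto
  qed
  then obtain \<delta> where \<delta>: "\<And>n. \<delta> n > 0" "\<And>n. \<delta> n \<le> r / 2 ^ n"
    and link: "\<And>n::nat. \<forall>x\<in>M. \<forall>y\<in>M. d x y < \<delta> n \<longrightarrow>
       (\<exists>C. connectedin mtopology C \<and> x \<in> C \<and> y \<in> C \<and> C \<subseteq> mball x (r / 2 ^ n))"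
    by metis
  have "\<exists>g. continuous_map (top_of_set {0..1::real}) mtopology g \<and> g 0 = x \<and> g 1 = y \<and>
           (\<forall>t\<in>{0..1}. d x (g t) < \<epsilon>)" if xy: "x \<in> M" "y \<in> M" "d x y < \<delta> 0" for x y
  proof -
    \<comment> \<open>A stage \<open>(K, f)\<close> is a chain \<open>f\<close> that arrives at \<open>y\<close> at index \<open>K\<close> and stays there;
      the clause for \<open>n = 0\<close> keeps the first chain near \<open>x\<close>. \<open>Q\<close> relates a stage to its refinement.\<close>
    define P where "P n Kf \<longleftrightarrow> (case Kf of (K, f) \<Rightarrow> K > 0 \<and> (\<forall>i. f i \<in> M) \<and> f 0 = x \<and> (\<forall>i\<ge>K. f i = y) \<and>
        (\<forall>i. d (f i) (f (Suc i)) < \<delta> n) \<and> (n = 0 \<longrightarrow> (\<forall>i. d x (f i) \<le> r)))"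
      for n and Kf :: "nat \<times> (nat \<Rightarrow> 'a)"
    define Q where "Q n Kf Kf' \<longleftrightarrow> (\<exists>k>0. fst Kf' = fst Kf * k \<and>
        (\<forall>m. d (snd Kf (m div k)) (snd Kf' m) < r / 2 ^ n))"
      for n and Kf Kf' :: "nat \<times> (nat \<Rightarrow> 'a)"
    have "\<exists>s. \<forall>n. P n (s n) \<and> Q n (s n) (s (Suc n))"
    proof (rule dependent_nat_choice)
      have "P 0 (1, \<lambda>i. if i = 0 then x else y)"
        unfolding P_def using xy \<delta>(1)[of 0] \<delta>(2)[of 0] r by auto
      then show "\<exists>s. P 0 s" by blast
    next
      fix s n assume Pn: "P n s"
      obtain K f where s: "s = (K, f)" by fastforce
      have f: "K > 0" "\<And>i. f i \<in> M" "f 0 = x" "\<forall>i\<ge>K. f i = y" "\<And>i. d (f i) (f (Suc i)) < \<delta> n"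
        using Pn unfolding s P_def by auto
      have \<rho>: "r / 2 ^ n > 0" using r by simp
      obtain k :: nat and g where k: "k > 0" "g 0 = f 0" "\<And>m. g m \<in> M" "\<And>m. m \<ge> K * k \<Longrightarrow> g m = y"
          "\<And>m. d (g m) (g (Suc m)) < \<delta> (Suc n)" "\<And>m. d (f (m div k)) (g m) < r / 2 ^ n"
        using chain_refinement[where f = f and K = K and b = y, OF link[of n] \<rho> \<delta>(1)[of "Suc n"] f(2,4,5)]
        by metis
      have "P (Suc n) (K * k, g)" unfolding P_def using k f by auto
      moreover have "Q n s (K * k, g)" unfolding Q_def s using k by auto
      ultimately show "\<exists>s'. P (Suc n) s' \<and> Q n s s'" by blast
    qed
    then obtain s where s: "\<And>n. P n (s n)" "\<And>n. Q n (s n) (s (Suc n))" by blast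
    define K where "K n = fst (s n)" for n
    define f where "f n = snd (s n)" for n
    have Kf: "K n > 0" "f n i \<in> M" "f n 0 = x" "\<forall>i\<ge>K n. f n i = y" "d (f n i) (f n (Suc i)) < \<delta> n"
      "n = 0 \<Longrightarrow> d x (f n i) \<le> r" for n i
      using s(1)[of n] unfolding P_def K_def f_def by (auto simp: case_prod_beta)
    have step: "d (f n i) (f n (Suc i)) < r / 2 ^ n" for n i
      using Kf(5)[of n i] \<delta>(2)[of n] by linarith
    have refine: "\<exists>k>0. K (Suc n) = K n * k \<and> (\<forall>m. d (f n (m div k)) (f (Suc n) m) < r / 2 ^ n)" for n
      using s(2)[of n] unfolding Q_def K_def f_def .
    obtain g where g: "continuous_map (top_of_set {0..1::real}) mtopology g" "g 0 = x" "g 1 = y"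
        "\<And>t. t \<in> {0..1} \<Longrightarrow> \<exists>i. d (f 0 i) (g t) \<le> 2 * r"
      using path_of_refining_chains[OF compact_space_imp_mcomplete[OF comp] Kf(1-4) step refine] by metis
    have "d x (g t) < \<epsilon>" if t: "t \<in> {0..1}" for t
    proof -
      obtain i where i: "d (f 0 i) (g t) \<le> 2 * r" using g(4)[OF t] by blast
      have "g t \<in> M" using g(1) t by (auto simp: continuous_map_def)
      then have "d x (g t) \<le> 3 * r" using triangle[of x "f 0 i" "g t"] xy(1) Kf(2) i Kf(6)[of 0 i] by simp
      then show ?thesis using r by (simp add: r_def)
    qed
    then show ?thesis using g(1-3) by (intro exI[of _ g]) simp
  qed
  then show thesis using that[OF \<delta>(1)[of 0]] by simp
qed

end

section \<open>One-dimensional spaces\<close>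

context Metric_space
begin

lemma fine_cover_of_order_two:
  assumes comp: "compact_space mtopology" and dim: "covering_dim_le mtopology 1" and \<rho>: "\<rho> > 0"
  obtains \<V> where "finite \<V>" "\<And>V. V \<in> \<V> \<Longrightarrow> openin mtopology V" "\<Union>\<V> = M" "{} \<notin> \<V>"
    "\<And>V x y. V \<in> \<V> \<Longrightarrow> x \<in> V \<Longrightarrow> y \<in> V \<Longrightarrow> d x y < \<rho>"
    "\<And>x. x \<in> M \<Longrightarrow> card {V \<in> \<V>. x \<in> V} \<le> 2"
proof -
  have "\<exists>\<F>. finite \<F> \<and> \<F> \<subseteq> (\<lambda>x. mball x (\<rho>/2)) ` M \<and> topspace mtopology \<subseteq> \<Union>\<F>"
    using comp unfolding compact_space_alt
  proof (elim allE impE)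
    show "Ball ((\<lambda>x. mball x (\<rho>/2)) ` M) (openin mtopology) \<and>
        topspace mtopology \<subseteq> \<Union>((\<lambda>x. mball x (\<rho>/2)) ` M)"
      using \<rho> by auto
  qed
  then obtain \<F> where \<F>: "finite \<F>" "\<F> \<subseteq> (\<lambda>x. mball x (\<rho>/2)) ` M" "M \<subseteq> \<Union>\<F>" by auto
  have cov: "finite \<F> \<and> (\<forall>U\<in>\<F>. openin mtopology U) \<and> \<Union>\<F> = topspace mtopology"
    using \<F> mball_subset_mspace by auto
  obtain \<V> where \<V>: "finite \<V>" "\<forall>V\<in>\<V>. openin mtopology V" "\<Union>\<V> = M" "\<forall>V\<in>\<V>. \<exists>U\<in>\<F>. V \<subseteq> U"
      "\<forall>x\<in>M. card {V \<in> \<V>. x \<in> V} \<le> 1 + 1"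
    using dim[unfolded covering_dim_le_def, THEN spec, THEN mp, OF cov] unfolding topspace_mtopology by blast
  show thesis
  proof (rule that[of "\<V> - {{}}"])
    show "d x y < \<rho>" if V: "V \<in> \<V> - {{}}" "x \<in> V" "y \<in> V" for V x y
    proof -
      obtain z where "V \<subseteq> mball z (\<rho>/2)" using V \<V>(4) \<F>(2) by blast
      then have "x \<in> mball z (\<rho>/2)" "y \<in> mball z (\<rho>/2)" using V by auto
      then show ?thesis using triangle[of x z y] commute[of x z] by auto
    qed
    show "card {V \<in> \<V> - {{}}. x \<in> V} \<le> 2" if "x \<in> M" for x
    proof -
      have "{V \<in> \<V> - {{}}. x \<in> V} = {V \<in> \<V>. x \<in> V}" by auto
      then show ?thesis using \<V>(5) that by (simp add: numeral_2_eq_2)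
    qed
  qed (use \<V> in auto)
qed

text \<open>
  The pairs in \<open>I\<close> are the vertices (\<open>V = W\<close>) and edges of the nerve of the cover \<open>\<V>\<close>. As no point
  lies in three members, the closed sets \<open>F V W\<close> of the points that lie in no member other than
  \<open>V\<close> and \<open>W\<close> cover the space. On \<open>F V W\<close>, an Urysohn function \<open>u V W\<close> that is 0 off \<open>W\<close> and 1 off
  \<open>V\<close> replaces the barycentric coordinate, and the map sought is \<open>\<gamma> V W \<circ> \<phi> \<circ> u V W\<close> for a short path
  \<open>\<gamma> V W\<close> from \<open>p V\<close> to \<open>p W\<close>. Two different sets \<open>F V W\<close> meet only in points that lie in a single
  member \<open>Z\<close>, and there all the definitions give \<open>p Z\<close>; so the pieces can be pasted.
\<close>
lemma one_dimensional_identity_approximation: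
  assumes comp: "compact_space mtopology" and lc: "locally_connected_space mtopology"
    and dim: "covering_dim_le mtopology 1" and \<epsilon>: "\<epsilon> > 0"
  obtains h where "continuous_map mtopology mtopology h" "generically mtopology (\<lambda>V. h constant_on V)"
    "\<And>x. x \<in> M \<Longrightarrow> d (h x) x < \<epsilon>"
proof -
  have "\<epsilon>/2 > 0" using \<epsilon> by simp
  then obtain \<delta> where \<delta>: "\<delta> > 0" and path: "\<And>x y. x \<in> M \<Longrightarrow> y \<in> M \<Longrightarrow> d x y < \<delta> \<Longrightarrow>
       \<exists>g. continuous_map (top_of_set {0..1::real}) mtopology g \<and> g 0 = x \<and> g 1 = y \<and>
           (\<forall>t\<in>{0..1}. d x (g t) < \<epsilon>/2)"
    using uniformly_locally_path_connected[OF comp lc] by metis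
  \<comment> \<open>Points of two intersecting members of the cover will be less than \<open>2 \<rho>\<close> apart.\<close>
  define \<rho> where "\<rho> = min \<delta> (\<epsilon>/2) / 2"
  have \<rho>: "\<rho> > 0" "2 * \<rho> \<le> \<delta>" "2 * \<rho> \<le> \<epsilon>/2" using \<delta> \<epsilon> by (auto simp: \<rho>_def)
  obtain \<V> where fin: "finite \<V>" and op: "\<And>V. V \<in> \<V> \<Longrightarrow> openin mtopology V" and cover: "\<Union>\<V> = M"
    and ne: "{} \<notin> \<V>" and small: "\<And>V x y. V \<in> \<V> \<Longrightarrow> x \<in> V \<Longrightarrow> y \<in> V \<Longrightarrow> d x y < \<rho>"
    and order: "\<And>x. x \<in> M \<Longrightarrow> card {V \<in> \<V>. x \<in> V} \<le> 2"
    using fine_cover_of_order_two[OF comp dim \<rho>(1)] by blast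
  define p where "p V = (SOME x. x \<in> V)" for V :: "'a set"
  have p: "p V \<in> V" if "V \<in> \<V>" for V
    using that ne unfolding p_def some_in_eq by metis
  have pM: "p V \<in> M" if "V \<in> \<V>" for V using p[OF that] cover that by blast
  have VM: "x \<in> M" if "V \<in> \<V>" "x \<in> V" for V x using that cover by blast
  have near: "d (p V) x < 2 * \<rho>" if V: "V \<in> \<V>" "W \<in> \<V>" "V \<inter> W \<noteq> {}" "x \<in> W" for V W x
  proof -
    obtain q where q: "q \<in> V" "q \<in> W" using V by blast
    then show ?thesis
      using triangle[of "p V" q x] small[OF V(1) p[OF V(1)] q(1)] small[OF V(2) q(2) V(4)] pM VM V
      by force
  qed
  \<comment> \<open>An arbitrary linear order of \<open>\<V>\<close> orients each edge, so that it is parametrised only once.\<close>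
  obtain rank :: "'a set \<Rightarrow> nat" where rank: "inj_on rank \<V>"
    using finite_imp_inj_to_nat_seg[OF fin] by blast
  define I where "I = {(V, W). V \<in> \<V> \<and> W \<in> \<V> \<and> rank V \<le> rank W \<and> V \<inter> W \<noteq> {}}"
  have finI: "finite I"
    by (rule finite_subset[of _ "\<V> \<times> \<V>"]) (use fin in \<open>auto simp: I_def\<close>)
  \<comment> \<open>For a vertex the path has to be constant, as no condition there determines the parameter \<open>u V V\<close>.\<close>
  define link where "link V W g \<longleftrightarrow> continuous_map (top_of_set {0..1::real}) mtopology g \<and>
      g 0 = p V \<and> g 1 = p W \<and> (\<forall>t\<in>{0..1}. d (p V) (g t) < \<epsilon>/2) \<and> (V = W \<longrightarrow> (\<forall>t. g t = p V))"
    for V W g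
  have ex_link: "\<exists>g. link V W g" if VW: "(V, W) \<in> I" for V W
  proof (cases "V = W")
    case True
    then show ?thesis using pM \<epsilon> VW by (intro exI[of _ "\<lambda>_. p V"]) (auto simp: I_def link_def)
  next
    case False
    have "d (p V) (p W) < \<delta>"
      using near[of V W "p W"] p[of W] VW \<rho>(2) by (auto simp: I_def)
    then show ?thesis using path[of "p V" "p W"] pM VW False by (auto simp: I_def link_def)
  qed
  define \<gamma> where "\<gamma> V W = (SOME g. link V W g)" for V W
  have "link V W (\<gamma> V W)" if "(V, W) \<in> I" for V W
    unfolding \<gamma>_def by (rule someI_ex[OF ex_link[OF that]])
  then have \<gamma>: "\<And>V W. (V, W) \<in> I \<Longrightarrow> continuous_map (top_of_set {0..1::real}) mtopology (\<gamma> V W)"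
      "\<And>V W. (V, W) \<in> I \<Longrightarrow> \<gamma> V W 0 = p V" "\<And>V W. (V, W) \<in> I \<Longrightarrow> \<gamma> V W 1 = p W"
      "\<And>V W t. (V, W) \<in> I \<Longrightarrow> t \<in> {0..1} \<Longrightarrow> d (p V) (\<gamma> V W t) < \<epsilon>/2"
      "\<And>V W t. (V, W) \<in> I \<Longrightarrow> V = W \<Longrightarrow> \<gamma> V W t = p V"
    unfolding link_def by blast+
  define F where "F V W = M - \<Union>(\<V> - {V, W})" for V W
  have cloF: "closedin mtopology (F V W)" for V W
  proof -
    have "openin mtopology (\<Union>(\<V> - {V, W}))" using op by blast
    then show ?thesis unfolding F_def by (metis closedin_diff closedin_topspace topspace_mtopology)
  qed
  have inF: "x \<in> F V W \<longleftrightarrow> x \<in> M \<and> {Z \<in> \<V>. x \<in> Z} \<subseteq> {V, W}" for x V W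
    unfolding F_def by blast
  have FVW: "x \<in> V \<or> x \<in> W" if "x \<in> F V W" for x V W
    using that cover unfolding F_def by blast
  define parameter where "parameter V W u \<longleftrightarrow> continuous_map mtopology (top_of_set {0..1::real}) u \<and>
      (\<forall>x\<in>F V W - W. u x = 0) \<and> (\<forall>x\<in>F V W - V. u x = 1)" for V W u
  have ex_parameter: "\<exists>u. parameter V W u" if VW: "(V, W) \<in> I" for V W
  proof -
    have "closedin mtopology (F V W - W)" "closedin mtopology (F V W - V)"
      using cloF op VW by (auto simp: I_def)
    moreover have "disjnt (F V W - W) (F V W - V)"
      using FVW by (auto simp: disjnt_def)
    ultimately obtain u where "continuous_map mtopology (top_of_set {0..1::real}) u"
        "u ` (F V W - W) \<subseteq> {0}" "u ` (F V W - V) \<subseteq> {1}"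
      using Urysohn_lemma[OF normal_space_mtopology, of "F V W - W" "F V W - V" 0 1] by auto
    then show ?thesis by (intro exI[of _ u]) (auto simp: parameter_def)
  qed
  define u where "u V W = (SOME u. parameter V W u)" for V W
  have "parameter V W (u V W)" if "(V, W) \<in> I" for V W
    unfolding u_def by (rule someI_ex[OF ex_parameter[OF that]])
  then have u: "\<And>V W. (V, W) \<in> I \<Longrightarrow> continuous_map mtopology (top_of_set {0..1::real}) (u V W)"
      "\<And>V W x. (V, W) \<in> I \<Longrightarrow> x \<in> F V W - W \<Longrightarrow> u V W x = 0"
      "\<And>V W x. (V, W) \<in> I \<Longrightarrow> x \<in> F V W - V \<Longrightarrow> u V W x = 1"
    unfolding parameter_def by blast+
  obtain \<phi> where \<phi>: "staircase \<phi>"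
    using staircase_close_to_identity[of 1] by auto
  have \<phi>c: "continuous_map (top_of_set {0..1}) (top_of_set {0..1}) \<phi>"
    using \<phi> unfolding staircase_def by (auto simp: continuous_map_in_subtopology)
  define k where "k V W = \<gamma> V W \<circ> (\<phi> \<circ> u V W)" for V W
  have uu: "continuous_map mtopology (top_of_set {0..1}) (\<phi> \<circ> u V W)" if "(V, W) \<in> I" for V W
    by (rule continuous_map_compose[OF u(1)[OF that] \<phi>c])
  have k: "continuous_map mtopology mtopology (k V W)" if "(V, W) \<in> I" for V W
    unfolding k_def by (rule continuous_map_compose[OF uu[OF that] \<gamma>(1)[OF that]])
  have k_single: "k V W x = p Z" if VW: "(V, W) \<in> I" and x: "x \<in> F V W" and Z: "{Z \<in> \<V>. x \<in> Z} = {Z}" for V W Z x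
  proof (cases "V = W")
    case True
    then have "Z = V" using x Z unfolding inF by auto
    then show ?thesis using \<gamma>(5)[OF VW True] by (simp add: k_def)
  next
    case False
    have VW': "V \<in> \<V>" "W \<in> \<V>" using VW by (auto simp: I_def)
    have "Z \<in> {V, W}" using x Z unfolding inF by auto
    then consider "Z = V" "x \<notin> W" | "Z = W" "x \<notin> V"
      using Z VW' False by blast
    then show ?thesis
      using u(2,3)[OF VW, of x] x \<gamma>(2,3)[OF VW] \<phi> by cases (auto simp: k_def staircase_def)
  qed
  have unique: "V = V' \<and> W = W' \<or> (\<exists>Z. {Z \<in> \<V>. x \<in> Z} = {Z})"
    if VW: "(V, W) \<in> I" "(V', W') \<in> I" and x: "x \<in> F V W" "x \<in> F V' W'" for x V W V' W'
  proof (rule disjCI)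
    assume not_single: "\<nexists>Z. {Z \<in> \<V>. x \<in> Z} = {Z}"
    have sub: "{Z \<in> \<V>. x \<in> Z} \<subseteq> {V, W}" "{Z \<in> \<V>. x \<in> Z} \<subseteq> {V', W'}"
      using x inF by blast+
    obtain A where A: "A \<in> {Z \<in> \<V>. x \<in> Z}" using x cover unfolding F_def by blast
    obtain B where B: "B \<in> {Z \<in> \<V>. x \<in> Z}" "B \<noteq> A" using not_single A by blast
    have "A \<in> {V, W}" "B \<in> {V, W}" "A \<in> {V', W'}" "B \<in> {V', W'}"
      using subsetD[OF sub(1)] subsetD[OF sub(2)] A B(1) by metis+
    then have "V \<noteq> W" "V' = V \<and> W' = W \<or> V' = W \<and> W' = V" using B(2) by auto
    moreover have "V = W" if "V' = W" "W' = V"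
    proof -
      have "V \<in> \<V>" "W \<in> \<V>" "rank V = rank W" using VW that by (auto simp: I_def)
      then show ?thesis using rank by (simp add: inj_on_eq_iff)
    qed
    ultimately show "V = V' \<and> W = W'" by metis
  qed
  have covered: "\<exists>V W. (V, W) \<in> I \<and> x \<in> F V W" if x: "x \<in> M" for x
  proof -
    let ?S = "{Z \<in> \<V>. x \<in> Z}"
    have "?S \<noteq> {}" using x cover by blast
    moreover have "finite ?S" using fin by simp
    ultimately have "card ?S \<noteq> 0" by simp
    then consider "card ?S = 1" | "card ?S = 2" using order[OF x] by linarith
    then obtain V W where VW: "?S = {V, W}"
      by cases (auto simp: card_1_singleton_iff card_2_iff)
    then have "V \<in> ?S" "W \<in> ?S" by auto
    then have "V \<in> \<V>" "W \<in> \<V>" "V \<inter> W \<noteq> {}" by auto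
    then have "(V, W) \<in> I \<or> (W, V) \<in> I" unfolding I_def using linear[of "rank V" "rank W"] by auto
    moreover have "x \<in> F V W" "x \<in> F W V" using VW x by (auto simp: inF)
    ultimately show ?thesis by blast
  qed
  have overlap: "k V W x = k V' W' x"
    if VW: "(V, W) \<in> I" "(V', W') \<in> I" "x \<in> F V W" "x \<in> F V' W'" for x V W V' W'
    using unique[OF VW] k_single[OF VW(1,3)] k_single[OF VW(2,4)] by metis
  obtain h where h: "continuous_map mtopology mtopology h"
    and hk: "\<And>x V W. (V, W) \<in> I \<Longrightarrow> x \<in> F V W \<Longrightarrow> h x = k V W x"
  proof (rule pasting_lemma_exists_closed[OF finI, of mtopology "\<lambda>(V, W). F V W" mtopology "\<lambda>(V, W). k V W"])
    show "topspace mtopology \<subseteq> \<Union>((\<lambda>(V, W). F V W) ` I)" using covered by fastforce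
    show "closedin mtopology (case i of (V, W) \<Rightarrow> F V W)" for i using cloF by (cases i) simp
    show "continuous_map (subtopology mtopology (case i of (V, W) \<Rightarrow> F V W)) mtopology (case i of (V, W) \<Rightarrow> k V W)"
      if "i \<in> I" for i
      using k[of "fst i" "snd i"] that by (simp add: case_prod_beta continuous_map_from_subtopology)
    show "(case i of (V, W) \<Rightarrow> k V W) x = (case j of (V, W) \<Rightarrow> k V W) x"
      if "i \<in> I" "j \<in> I" "x \<in> topspace mtopology \<inter> (case i of (V, W) \<Rightarrow> F V W) \<inter> (case j of (V, W) \<Rightarrow> F V W)"
      for i j x
      using that overlap[of "fst i" "snd i" "fst j" "snd j" x] by (simp add: case_prod_beta)
    fix g assume g: "continuous_map mtopology mtopology g"
      "\<And>x i. i \<in> I \<Longrightarrow> x \<in> topspace mtopology \<inter> (case i of (V, W) \<Rightarrow> F V W) \<Longrightarrow>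
         g x = (case i of (V, W) \<Rightarrow> k V W) x"
    have "g x = k V W x" if "(V, W) \<in> I" "x \<in> F V W" for x V W
      using g(2)[OF that(1), of x] that(2) by (simp add: inF)
    then show thesis using that g(1) by blast
  qed
  have unit: "\<phi> (u V W x) \<in> {0..1}" if "(V, W) \<in> I" "x \<in> M" for V W x
    using uu[OF that(1)] that(2) by (auto simp: continuous_map_def)
  have close: "d (h x) x < \<epsilon>" if x: "x \<in> M" for x
  proof -
    obtain V W where VW: "(V, W) \<in> I" "x \<in> F V W" using covered[OF x] by blast
    then have VW': "V \<in> \<V>" "W \<in> \<V>" "V \<inter> W \<noteq> {}" by (auto simp: I_def)
    have hx: "h x \<in> M" using h x by (auto simp: continuous_map_def)
    have "d (p V) (h x) < \<epsilon>/2"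
      using \<gamma>(4)[OF VW(1) unit[OF VW(1) x]] by (simp add: hk[OF VW] k_def)
    moreover have "d (p V) x < \<epsilon>/2"
      using FVW[OF VW(2)]
    proof
      assume "x \<in> V"
      then show ?thesis using near[of V V x] VW' \<rho>(3) by fastforce
    next
      assume "x \<in> W"
      then show ?thesis using near[OF VW'] \<rho>(3) by fastforce
    qed
    ultimately show ?thesis
      using triangle[of "h x" "p V" x] hx x pM[OF VW'(1)] commute[of "h x" "p V"] by simp
  qed
  have generic: "generically mtopology (\<lambda>V. h constant_on V)"
  proof -
    have "generically mtopology (\<lambda>U. \<forall>i\<in>I. (U \<subseteq> case_prod F i \<or> U \<inter> case_prod F i = {}) \<and>
            (\<phi> \<circ> case_prod u i) constant_on U)"
    proof (rule generically_ball_finite[OF finI])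
      fix i assume i: "i \<in> I"
      show "generically mtopology (\<lambda>U. (U \<subseteq> case_prod F i \<or> U \<inter> case_prod F i = {}) \<and>
            (\<phi> \<circ> case_prod u i) constant_on U)"
      proof (rule generically_conj)
        show "generically mtopology (\<lambda>U. U \<subseteq> case_prod F i \<or> U \<inter> case_prod F i = {})"
          using generically_closed_decided[OF cloF] by (simp add: case_prod_beta)
        show "generically mtopology (\<lambda>U. (\<phi> \<circ> case_prod u i) constant_on U)"
          using generically_constant_staircase[OF lc \<phi> u(1)[of "fst i" "snd i"]] i by (simp add: case_prod_beta)
      qed blast
    next
      fix i U U'
      assume U': "(U' \<subseteq> case_prod F i \<or> U' \<inter> case_prod F i = {}) \<and>
            (\<phi> \<circ> case_prod u i) constant_on U'" and "U \<subseteq> U'"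
      then have "U \<subseteq> case_prod F i \<or> U \<inter> case_prod F i = {}" by blast
      then show "(U \<subseteq> case_prod F i \<or> U \<inter> case_prod F i = {}) \<and>
            (\<phi> \<circ> case_prod u i) constant_on U"
        using constant_on_subset[OF conjunct2[OF U'] \<open>U \<subseteq> U'\<close>] by blast
    qed
    then show ?thesis
    proof (rule generically_mono)
      fix U assume U: "openin mtopology U" "U \<noteq> {}"
        and dec: "\<forall>i\<in>I. (U \<subseteq> case_prod F i \<or> U \<inter> case_prod F i = {}) \<and>
            (\<phi> \<circ> case_prod u i) constant_on U"
      obtain x where x: "x \<in> U" using U by blast
      then have "x \<in> M" using openin_subset[OF U(1)] by auto
      then obtain V W where VW: "(V, W) \<in> I" "x \<in> F V W" using covered by blast
      have "U \<subseteq> F V W" "(\<phi> \<circ> u V W) constant_on U"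
        using bspec[OF dec VW(1)] VW(2) x by auto
      then obtain c where "\<And>y. y \<in> U \<Longrightarrow> (\<phi> \<circ> u V W) y = c" unfolding constant_on_def by blast
      then have "h y = \<gamma> V W c" if "y \<in> U" for y
        using hk[OF VW(1)] \<open>U \<subseteq> F V W\<close> that by (simp add: k_def subset_iff)
      then show "h constant_on U" unfolding constant_on_def by blast
    qed
  qed
  show thesis by (rule that[OF h generic close])
qed

end

section \<open>Density of locally constant maps\<close>

theorem theorem8:
  fixes X :: "'a topology" and m :: "'a metric"
  assumes "peano_continuum X"
    and "one_dimensional X \<or> compact_ANR X"
    and "mtopology_of m = X"
  shows "uniform_topology m closure_of LC_maps X = C_maps X"
proof -
  interpret Metric_space "mspace m" "mdist m" by (rule Metric_space_mspace_mdist)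
  have X: "mtopology = X" using assms(3) by (simp add: mtopology_of_def)
  have comp: "compact_space X" and lc: "locally_connected_space X"
    using assms(1) by (auto simp: peano_continuum_def continuum_def)
  have topX: "topspace X = mspace m" using X by auto
  have approx: "\<exists>h. continuous_map X X h \<and> generically X (\<lambda>V. h constant_on V) \<and>
      (\<forall>x\<in>mspace m. mdist m (h x) x < \<delta>)" if "\<delta> > 0" for \<delta>
    using assms(2)
  proof
    assume "one_dimensional X"
    then have "covering_dim_le X 1" by (simp add: one_dimensional_def)
    then show ?thesis
      using one_dimensional_identity_approximation[unfolded X, OF comp lc _ that] by metis
  next
    assume "compact_ANR X"
    then show ?thesis
      using ANR_identity_approximation[unfolded X, OF comp lc _ that] by metis
  qed
  show ?thesis
  proof
    show "uniform_topology m closure_of LC_maps X \<subseteq> C_maps X"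
      using closure_of_subset_topspace[of "uniform_topology m"] assms(3) by simp
    show "C_maps X \<subseteq> uniform_topology m closure_of LC_maps X"
    proof
      fix f assume f: "f \<in> C_maps X"
      then have fc: "continuous_map X X f" by (simp add: C_maps_def)
      have "\<exists>g. g \<in> LC_maps X \<and> g \<in> W" if W: "f \<in> W" "openin (uniform_topology m) W" for W
      proof -
        obtain e where e: "e > 0" "\<And>g. g \<in> C_maps X \<Longrightarrow> (\<forall>x\<in>mspace m. mdist m (f x) (g x) < e) \<Longrightarrow> g \<in> W"
          using W unfolding openin_uniform_topology assms(3) by blast
        have "uniformly_continuous_map m m f"
          using fc comp assms(3) continuous_eq_uniformly_continuous_map by blast
        then obtain \<delta> where \<delta>: "\<delta> > 0" "\<And>x y. x \<in> mspace m \<Longrightarrow> y \<in> mspace m \<Longrightarrow> mdist m y x < \<delta> \<Longrightarrow>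
            mdist m (f y) (f x) < e"
          using e(1) unfolding uniformly_continuous_map_def by metis
        obtain h where h: "continuous_map X X h" "generically X (\<lambda>V. h constant_on V)"
            "\<And>x. x \<in> mspace m \<Longrightarrow> mdist m (h x) x < \<delta>"
          using approx[OF \<delta>(1)] by blast
        define g where "g = restrict (f \<circ> h) (topspace X)"
        have "continuous_map X X (f \<circ> h)" by (rule continuous_map_compose[OF h(1) fc])
        then have "continuous_map X X g" by (rule continuous_map_eq) (simp add: g_def)
        then have gC: "g \<in> C_maps X" by (simp add: C_maps_def g_def)
        have "generically X (\<lambda>V. g constant_on V)"
        proof (rule generically_mono[OF h(2)])
          fix V assume "openin X V" "h constant_on V"
          then show "g constant_on V"
            using openin_subset unfolding constant_on_def g_def by (metis comp_apply restrict_apply' subsetD)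
        qed
        with gC have "g \<in> LC_maps X" by (rule LC_mapsI)
        moreover have "mdist m (f x) (g x) < e" if "x \<in> mspace m" for x
        proof -
          have "h x \<in> mspace m" using h(1) that topX by (auto simp: continuous_map_def)
          then show ?thesis using \<delta>(2)[of "x" "h x"] h(3) that topX commute by (simp add: g_def)
        qed
        ultimately show ?thesis using e(2) gC by blast
      qed
      then show "f \<in> uniform_topology m closure_of LC_maps X"
        using f assms(3) unfolding in_closure_of by auto
    qed
  qed
qed

end
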